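(* Let $G$ be a locally finite graph which has homogeneous growth with respect to a vertex $g_0$, let $s_n$ be the number of vertices at distance exactly $n$ from $g_0$, and let $\{f_n\}_{n\ge1}$ be a non-decreasing sequence of positive integers. If $G$ has the $\{f_n\}$-containment property, then the series $\sum_{n=1}^\infty \frac{f_n}{s_n}$ diverges.
   Context: Let $S_n$ be the set of vertices at combinatorial distance exactly $n$ from $g_0$ and $s_n=|S_n|$. For $T\subseteq S_n$, $T^*$ is the set of vertices of $S_{n+1}$ adjacent to at least one vertex of $T$. $G$ has homogeneous growth with respect to $g_0$ if there is $r\ge0$ such that for every $n\ge r$ and every non-empty $T\subseteq S_n$, $\frac{|T^*|}{|T|}\ge \frac{s_{n+1}}{s_n}\ge 1$. Given a finite set $X_0$ of vertices, a sequence $\{W_k\}_{k\geq1}$ of vertex sets is an $\{f_n\}$-containment strategy for $X_0$ if: (1) $|W_n|\le f_n$ for all $n\ge1$; (2) $X_n\cap W_{n+1}=\emptyset$ for all $n\ge0$, where for $n>0$, $X_n$ is the set of vertices connected to a vertex of $X_{n-1}$ by a path of length at most $1$ containing no vertex of $W_1\cup\cdots\cup W_n$; (3) there is $N>0$ with $X_n=X_N$ for all $n\ge N$. $G$ has the $\{f_n\}$-containment property if every finite vertex set admits such a strategy. *)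

theory Defs
  imports Complex_Main "HOL-Library.Extended_Nat" "HOL-Library.Extended_Nonnegative_Real"
begin

locale simple_graph =
  fixes V :: "'a set" and E :: "'a set set"
  assumes edge_ends: "e \<in> E \<Longrightarrow> \<exists>u\<in>V. \<exists>v\<in>V. u \<noteq> v \<and> e = {u, v}"

locale locally_finite_graph = simple_graph +
  assumes finite_neighbours: "v \<in> V \<Longrightarrow> finite {w. {v, w} \<in> E}"

text \<open>A path is given by its non-empty list of vertices; its length is the number of edges,
  \<open>length p - 1\<close>.\<close>

definition path_between :: "'a set \<Rightarrow> 'a set set \<Rightarrow> 'a \<Rightarrow> 'a list \<Rightarrow> 'a \<Rightarrow> bool" where
  "path_between V E u p v \<longleftrightarrow>
     p \<noteq> [] \<and> set p \<subseteq> V \<and> distinct p \<and> successively (\<lambda>x y. {x, y} \<in> E) p \<and> hd p = u \<and> last p = v"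

definition path_length :: "'a list \<Rightarrow> nat" where
  "path_length p = length p - 1"

text \<open>The graph need not be connected: the distance is \<open>\<infinity>\<close> if there is no path.\<close>

definition graph_dist :: "'a set \<Rightarrow> 'a set set \<Rightarrow> 'a \<Rightarrow> 'a \<Rightarrow> enat" where
  "graph_dist V E u v = (INF p \<in> {p. path_between V E u p v}. enat (path_length p))"

definition sphere_at :: "'a set \<Rightarrow> 'a set set \<Rightarrow> 'a \<Rightarrow> nat \<Rightarrow> 'a set" where
  "sphere_at V E g\<^sub>0 n = {v \<in> V. graph_dist V E g\<^sub>0 v = enat n}"

definition sphere_size :: "'a set \<Rightarrow> 'a set set \<Rightarrow> 'a \<Rightarrow> nat \<Rightarrow> nat" where
  "sphere_size V E g\<^sub>0 n = card (sphere_at V E g\<^sub>0 n)"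

definition out_neighbours :: "'a set \<Rightarrow> 'a set set \<Rightarrow> 'a \<Rightarrow> nat \<Rightarrow> 'a set \<Rightarrow> 'a set" where
  "out_neighbours V E g\<^sub>0 n T = {v \<in> sphere_at V E g\<^sub>0 (Suc n). \<exists>t\<in>T. {t, v} \<in> E}"

definition homogeneous_growth :: "'a set \<Rightarrow> 'a set set \<Rightarrow> 'a \<Rightarrow> bool" where
  "homogeneous_growth V E g\<^sub>0 \<longleftrightarrow>
     (\<exists>r. \<forall>n\<ge>r. \<forall>T. T \<subseteq> sphere_at V E g\<^sub>0 n \<and> T \<noteq> {} \<longrightarrow>
        real (card (out_neighbours V E g\<^sub>0 n T)) / real (card T)
          \<ge> real (sphere_size V E g\<^sub>0 (Suc n)) / real (sphere_size V E g\<^sub>0 n) \<and>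
        real (sphere_size V E g\<^sub>0 (Suc n)) / real (sphere_size V E g\<^sub>0 n) \<ge> 1)"

text \<open>Strategies and bounds are indexed by positive integers; \<open>W 0\<close> and \<open>f 0\<close> are never used.\<close>

primrec burning :: "'a set \<Rightarrow> 'a set set \<Rightarrow> (nat \<Rightarrow> 'a set) \<Rightarrow> 'a set \<Rightarrow> nat \<Rightarrow> 'a set" where
  "burning V E W X\<^sub>0 0 = X\<^sub>0"
| "burning V E W X\<^sub>0 (Suc n) =
     {v. \<exists>x \<in> burning V E W X\<^sub>0 n. \<exists>p. path_between V E x p v \<and> path_length p \<le> 1 \<and>
           set p \<inter> (\<Union>k\<in>{1..Suc n}. W k) = {}}"

definition containment_strategy ::
  "'a set \<Rightarrow> 'a set set \<Rightarrow> (nat \<Rightarrow> nat) \<Rightarrow> 'a set \<Rightarrow> (nat \<Rightarrow> 'a set) \<Rightarrow> bool" where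
  "containment_strategy V E f X\<^sub>0 W \<longleftrightarrow>
     (\<forall>n\<ge>1. W n \<subseteq> V \<and> finite (W n) \<and> card (W n) \<le> f n) \<and>
     (\<forall>n. burning V E W X\<^sub>0 n \<inter> W (Suc n) = {}) \<and>
     (\<exists>N>0. \<forall>n\<ge>N. burning V E W X\<^sub>0 n = burning V E W X\<^sub>0 N)"

definition containment_property :: "'a set \<Rightarrow> 'a set set \<Rightarrow> (nat \<Rightarrow> nat) \<Rightarrow> bool" where
  "containment_property V E f \<longleftrightarrow>
     (\<forall>X\<^sub>0. X\<^sub>0 \<subseteq> V \<and> finite X\<^sub>0 \<longrightarrow> (\<exists>W. containment_strategy V E f X\<^sub>0 W))"

text \<open>The series \<open>f\<^sub>n / s\<^sub>n\<close> is summed in \<open>ennreal\<close>: a term with empty sphere (in a locally finite graph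
  this happens only if the component of \<open>g\<^sub>0\<close> is finite) has value \<open>\<infinity>\<close>, whereas in \<open>real\<close> it would
  be \<open>0\<close>. If no sphere is empty, the sum is \<open>\<infinity>\<close> exactly if the real series diverges.\<close>

lemma series_infinite_iff_not_summable:
  fixes f s :: "nat \<Rightarrow> nat"
  assumes "\<And>n. s (Suc n) > 0"
  shows "(\<Sum>n. of_nat (f (Suc n)) / of_nat (s (Suc n)) :: ennreal) = \<infinity> \<longleftrightarrow>
    \<not> summable (\<lambda>n. real (f (Suc n)) / real (s (Suc n)))"
proof -
  have eq: "of_nat (f (Suc n)) / of_nat (s (Suc n)) = ennreal (real (f (Suc n)) / real (s (Suc n)))"
    for n
    using assms[of n] by (simp add: divide_ennreal ennreal_of_nat_eq_real_of_nat)
  let ?g = "\<lambda>n. real (f (Suc n)) / real (s (Suc n))"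
  have nonneg: "0 \<le> ?g n" for n
    by simp
  have "(\<Sum>n. ennreal (?g n)) = \<infinity> \<longleftrightarrow> \<not> summable ?g"
  proof
    assume inf: "(\<Sum>n. ennreal (?g n)) = \<infinity>"
    show "\<not> summable ?g"
    proof
      assume "summable ?g"
      from suminf_ennreal2[OF nonneg this] inf
      have "ennreal (suminf ?g) = \<infinity>"
        by metis
      then show False
        using ennreal_neq_top by (metis infinity_ennreal_def)
    qed
  next
    assume "\<not> summable ?g"
    then show "(\<Sum>n. ennreal (?g n)) = \<infinity>"
      using summable_suminf_not_top[of ?g, OF nonneg] by (metis infinity_ennreal_def)
  qed
  then show ?thesis
    unfolding eq .
qed

end

(*
  Start the fire on a ball of radius R centred at g0 and let c n be the fraction of the sphere of
  radius R + n that burns at time n. By homogeneous growth c (n + 1) is at least c n minus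
  w / s (R + n + 1), where w is the number of vertices of that sphere protected by time n + 1. A
  vertex protected at time k is charged at most once, in a sphere of radius at least R + k, hence at
  most 1 / s (R + k) as s is non-decreasing. So the total loss is at most the sum of
  f k / s (R + k) <= f (R + k) / s (R + k), a tail of the series. If the series converged, this tail
  would be less than 1 for large R, and the fire would reach every sphere.
*)
theory Submission
  imports Defs
begin

section \<open>Distance balls and short paths\<close>

definition ball_at :: "'a set \<Rightarrow> 'a set set \<Rightarrow> 'a \<Rightarrow> nat \<Rightarrow> 'a set" where
  "ball_at V E g n = {v. graph_dist V E g v \<le> enat n}"

text \<open>A non-empty set of extended naturals attains its infimum; the infimum of the empty set
  is infinite and so exceeds \<open>enat n\<close>.\<close>

lemma graph_dist_le_iff:
  "graph_dist V E u v \<le> enat n \<longleftrightarrow> (\<exists>p. path_between V E u p v \<and> path_length p \<le> n)"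
proof
  let ?A = "(\<lambda>p. enat (path_length p)) ` {p. path_between V E u p v}"
  assume le: "graph_dist V E u v \<le> enat n"
  have "?A \<noteq> {}"
  proof
    assume "?A = {}"
    then show False
      using le by (simp only: graph_dist_def) (simp add: top_enat_def)
  qed
  then have "Inf ?A \<in> ?A"
    by (metis Inf_enat_def LeastI_ex equals0I)
  then show "\<exists>p. path_between V E u p v \<and> path_length p \<le> n"
    using le unfolding graph_dist_def by auto
next
  assume "\<exists>p. path_between V E u p v \<and> path_length p \<le> n"
  then show "graph_dist V E u v \<le> enat n"
    unfolding graph_dist_def by (auto intro: INF_lower2)
qed

lemma ball_at_iff:
  "v \<in> ball_at V E g n \<longleftrightarrow> (\<exists>p. path_between V E g p v \<and> path_length p \<le> n)"
  by (simp add: ball_at_def graph_dist_le_iff)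

lemma path_between_end: "path_between V E u p v \<Longrightarrow> v \<in> set p"
  unfolding path_between_def by (metis last_in_set)

text \<open>Paths stay inside \<open>V\<close>, so a point outside is at infinite distance; this is
  why \<open>ball_at\<close> carries no condition on membership in \<open>V\<close>.\<close>

lemma ball_at_subset: "ball_at V E g n \<subseteq> V"
proof
  fix v
  assume "v \<in> ball_at V E g n"
  then obtain p where "path_between V E g p v"
    by (auto simp: ball_at_iff)
  then show "v \<in> V"
    using path_between_end[of V E g p v] by (auto simp: path_between_def)
qed

lemma ball_at_mono: "m \<le> n \<Longrightarrow> ball_at V E g m \<subseteq> ball_at V E g n"
  by (auto simp: ball_at_def intro: order_trans)

lemma sphere_at_subset_ball: "sphere_at V E g n \<subseteq> ball_at V E g n"
  by (auto simp: sphere_at_def ball_at_def)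

lemma sphere_at_disjoint_ball: "m < n \<Longrightarrow> sphere_at V E g n \<inter> ball_at V E g m = {}"
  by (auto simp: sphere_at_def ball_at_def)

lemma sphere_at_disjoint: "m \<noteq> n \<Longrightarrow> sphere_at V E g m \<inter> sphere_at V E g n = {}"
  by (auto simp: sphere_at_def)

lemma path_between_length_le_1:
  assumes "path_between V E x p v" "path_length p \<le> 1"
  shows "p = [x] \<and> v = x \<or> p = [x, v] \<and> {x, v} \<in> E"
proof -
  have "p \<noteq> []" "length p \<le> 2"
    using assms by (auto simp: path_between_def path_length_def)
  then consider a where "p = [a]" | a b where "p = [a, b]"
    by (cases p; cases "tl p") auto
  then show ?thesis
    using assms by cases (auto simp: path_between_def)
qed

section \<open>One step outwards: balls and the fire\<close>

context simple_graph
begin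

lemma edge_verts: "{u, v} \<in> E \<Longrightarrow> u \<in> V \<and> v \<in> V \<and> u \<noteq> v"
  using edge_ends[of "{u, v}"] by (auto simp: doubleton_eq_iff)

text \<open>Paths have distinct vertices, so \<open>v\<close> can be appended only if it is new;
  otherwise the path is cut off at \<open>v\<close>.\<close>

lemma ball_at_neighbour:
  assumes "u \<in> ball_at V E g n" "{u, v} \<in> E"
  shows "v \<in> ball_at V E g (Suc n)"
proof -
  obtain p where p: "path_between V E g p u" "path_length p \<le> n"
    using assms by (auto simp: ball_at_iff)
  show ?thesis
  proof (cases "v \<in> set p")
    case True
    then obtain ys zs where "p = ys @ v # zs"
      by (meson split_list)
    then have "path_between V E g (ys @ [v]) v" "path_length (ys @ [v]) \<le> Suc n"
      using p by (auto simp: path_between_def path_length_def successively_append_iff hd_append)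
    then show ?thesis
      by (auto simp: ball_at_iff)
  next
    case False
    then have "path_between V E g (p @ [v]) v" "path_length (p @ [v]) \<le> Suc n"
      using p assms edge_verts
      by (auto simp: path_between_def path_length_def successively_append_iff hd_append)
    then show ?thesis
      by (auto simp: ball_at_iff)
  qed
qed

text \<open>Dropping the last vertex of a path shortens it by one. The extra \<open>g\<close>
  accounts for the one-vertex path, from which nothing is left.\<close>

lemma ball_at_Suc_subset:
  "ball_at V E g (Suc n) \<subseteq> insert g (\<Union>u\<in>ball_at V E g n. {v. {u, v} \<in> E})"
proof
  fix v
  assume "v \<in> ball_at V E g (Suc n)"
  then obtain p where p: "path_between V E g p v" "path_length p \<le> Suc n"
    by (auto simp: ball_at_iff)
  then obtain q where q: "p = q @ [v]"
    by (metis append_butlast_last_id path_between_def)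
  show "v \<in> insert g (\<Union>u\<in>ball_at V E g n. {v. {u, v} \<in> E})"
  proof (cases "q = []")
    case True
    then show ?thesis
      using p q by (auto simp: path_between_def)
  next
    case False
    then have "path_between V E g q (last q)" "path_length q \<le> n" "{last q, v} \<in> E"
      using p q by (auto simp: path_between_def path_length_def successively_append_iff)
    then have "last q \<in> ball_at V E g n" "{last q, v} \<in> E"
      unfolding ball_at_iff by blast+
    then show ?thesis
      by blast
  qed
qed

text \<open>A path of length at most 1 is a vertex or an edge. The hypothesis makes \<open>x\<close>
  a vertex, as the path \<open>[x]\<close> requires. Both ends have to be unprotected, the source
  \<open>x\<close> included.\<close>

lemma burning_Suc_iff:
  assumes "burning V E W X n \<subseteq> V"
  shows "v \<in> burning V E W X (Suc n) \<longleftrightarrow>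
    (\<exists>x\<in>burning V E W X n. (v = x \<or> {x, v} \<in> E) \<and>
      x \<notin> (\<Union>k\<in>{1..Suc n}. W k) \<and> v \<notin> (\<Union>k\<in>{1..Suc n}. W k))"
    (is "_ \<longleftrightarrow> (\<exists>x\<in>_. ?Q x)")
proof -
  have "(\<exists>p. path_between V E x p v \<and> path_length p \<le> 1 \<and> set p \<inter> (\<Union>k\<in>{1..Suc n}. W k) = {})
      \<longleftrightarrow> ?Q x" (is "?L \<longleftrightarrow> _") if "x \<in> V" for x
  proof
    assume ?L
    then show "?Q x"
      using path_between_length_le_1[of V E x _ v] by fastforce
  next
    assume Q: "?Q x"
    let ?p = "if v = x then [x] else [x, v]"
    have "path_between V E x ?p v" "path_length ?p \<le> 1"
      using Q that edge_verts by (auto simp: path_between_def path_length_def)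
    moreover have "set ?p \<inter> (\<Union>k\<in>{1..Suc n}. W k) = {}"
      using Q by auto
    ultimately show ?L
      by blast
  qed
  then show ?thesis
    using assms unfolding burning.simps(2) mem_Collect_eq by (intro bex_cong refl) blast
qed

text \<open>The fire crosses at most one edge per step. This keeps it inside \<open>V\<close> and
  later supplies the upper bound on its reach.\<close>

lemma burning_subset_ball:
  assumes "X \<subseteq> ball_at V E g R"
  shows "burning V E W X n \<subseteq> ball_at V E g (R + n)"
proof (induction n)
  case 0
  then show ?case
    using assms by simp
next
  case (Suc n)
  then have XV: "burning V E W X n \<subseteq> V"
    using ball_at_subset by fast
  show ?case
  proof
    fix v
    assume "v \<in> burning V E W X (Suc n)"
    then obtain x where "x \<in> ball_at V E g (R + n)" "v = x \<or> {x, v} \<in> E"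
      using Suc burning_Suc_iff[OF XV] by blast
    then show "v \<in> ball_at V E g (R + Suc n)"
      using ball_at_neighbour ball_at_mono[of "R + n" "R + Suc n" V E g] by auto
  qed
qed

end

text \<open>The path that witnesses burning at time \<open>n\<close> ends in the burning vertex and
  avoids everything protected up to time \<open>n\<close>.\<close>

lemma burning_disjoint_protected:
  assumes "k \<in> {1..n}"
  shows "burning V E W X n \<inter> W k = {}"
proof -
  obtain m where n: "n = Suc m"
    using assms by (cases n) auto
  show ?thesis
    unfolding n using assms n path_between_end by fastforce
qed

section \<open>Finiteness of balls and spheres\<close>

context locally_finite_graph
begin

lemma finite_ball_at: "finite (ball_at V E g n)"
proof (induction n)
  case 0
  have "ball_at V E g 0 \<subseteq> {g}"
  proof
    fix v
    assume "v \<in> ball_at V E g 0"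
    then obtain p where "path_between V E g p v" "path_length p = 0"
      by (auto simp: ball_at_iff)
    then show "v \<in> {g}"
      using path_between_length_le_1[of V E g p v] by (auto simp: path_length_def)
  qed
  then show ?case
    by (rule finite_subset) simp
next
  case (Suc n)
  then have "finite (insert g (\<Union>u\<in>ball_at V E g n. {v. {u, v} \<in> E}))"
    using ball_at_subset[of V E g n] finite_neighbours by (intro finite.insertI finite_UN_I) auto
  then show ?case
    using ball_at_Suc_subset by (rule rev_finite_subset)
qed

lemma finite_sphere_at: "finite (sphere_at V E g n)"
  using finite_ball_at sphere_at_subset_ball by (rule rev_finite_subset)

end

section \<open>Tails of series and the charging of protected vertices\<close>

lemma tail_sums_less:
  fixes g :: "nat \<Rightarrow> real"
  assumes "summable g" "\<And>n. 0 \<le> g n" "0 < e"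
  obtains R where "r \<le> R" "\<And>m. (\<Sum>k<m. g (k + R)) < e"
proof -
  obtain N where N: "\<And>n. n \<ge> N \<Longrightarrow> norm (\<Sum>i. g (i + n)) < e"
    using suminf_exist_split[OF assms(3,1)] by blast
  have "(\<Sum>k<m. g (k + max r N)) < e" for m
  proof -
    have "(\<Sum>k<m. g (k + max r N)) \<le> (\<Sum>k. g (k + max r N))"
      using assms by (intro sum_le_suminf) (auto simp: summable_iff_shift)
    also have "\<dots> < e"
      using N[of "max r N"] by simp
    finally show ?thesis .
  qed
  then show ?thesis
    by (intro that[of "max r N"]) auto
qed

lemma sum_card_Int_disjoint_le:
  assumes "finite W" "finite I" "\<And>i j. i \<noteq> j \<Longrightarrow> S i \<inter> S j = {}"
  shows "(\<Sum>i\<in>I. card (S i \<inter> W)) \<le> card W"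
proof -
  have "(\<Sum>i\<in>I. card (S i \<inter> W)) = card (\<Union>i\<in>I. S i \<inter> W)"
    using assms by (intro card_UN_disjoint[symmetric]) auto
  also have "\<dots> \<le> card W"
    using assms by (intro card_mono) auto
  finally show ?thesis .
qed

text \<open>Double counting over pairs \<open>k \<le> n\<close> of a protection time and a sphere;
  in the application \<open>S n\<close> is the sphere of radius \<open>R + n\<close> and
  \<open>s n\<close> its size.\<close>

lemma sum_protected_le:
  fixes s :: "nat \<Rightarrow> real"
  assumes fin: "\<And>k. k \<ge> 1 \<Longrightarrow> finite (W k)"
    and disj: "\<And>i j. i \<noteq> j \<Longrightarrow> S i \<inter> S j = {}"
    and pos: "\<And>n. 0 < s n" and mono: "\<And>m n. m \<le> n \<Longrightarrow> s m \<le> s n"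
  shows "(\<Sum>n=1..m. card (S n \<inter> (\<Union>k\<in>{1..n}. W k)) / s n) \<le> (\<Sum>k=1..m. card (W k) / s k)"
proof -
  \<comment> \<open>The range \<open>{1..n}\<close> is written as a restriction of
    \<open>{1..m}\<close>, the shape in which \<open>sum.swap_restrict\<close> exchanges the
    sums.\<close>
  have "(\<Sum>n=1..m. card (S n \<inter> (\<Union>k\<in>{1..n}. W k)) / s n) \<le>
      (\<Sum>n=1..m. \<Sum>k | k \<in> {1..m} \<and> k \<le> n. card (S n \<inter> W k) / s k)"
  proof (rule sum_mono)
    fix n
    assume n: "n \<in> {1..m}"
    then have eq: "{k. k \<in> {1..m} \<and> k \<le> n} = {1..n}"
      by auto
    have "card (S n \<inter> (\<Union>k\<in>{1..n}. W k)) \<le> (\<Sum>k=1..n. card (S n \<inter> W k))"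
      unfolding Int_UN_distrib by (rule card_UN_le) simp
    then have "card (S n \<inter> (\<Union>k\<in>{1..n}. W k)) / s n \<le> (\<Sum>k=1..n. card (S n \<inter> W k) / s n)"
      using pos[of n] by (simp add: sum_divide_distrib[symmetric] divide_right_mono
          flip: of_nat_sum)
    \<comment> \<open>As \<open>s k \<le> s n\<close>, the weight may depend on the protection time
      alone, and is then constant when summing over \<open>n\<close>.\<close>
    also have "\<dots> \<le> (\<Sum>k=1..n. card (S n \<inter> W k) / s k)"
      using pos mono by (intro sum_mono divide_left_mono) auto
    finally show "card (S n \<inter> (\<Union>k\<in>{1..n}. W k)) / s n \<le>
        (\<Sum>k | k \<in> {1..m} \<and> k \<le> n. card (S n \<inter> W k) / s k)"
      unfolding eq .
  qed
  also have "\<dots> = (\<Sum>k=1..m. \<Sum>n | n \<in> {1..m} \<and> k \<le> n. card (S n \<inter> W k) / s k)"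
    by (rule sum.swap_restrict) auto
  also have "\<dots> \<le> (\<Sum>k=1..m. card (W k) / s k)"
  proof (rule sum_mono)
    fix k
    assume k: "k \<in> {1..m}"
    have "(\<Sum>n | n \<in> {1..m} \<and> k \<le> n. card (S n \<inter> W k)) \<le> card (W k)"
      using fin k disj by (intro sum_card_Int_disjoint_le) auto
    then show "(\<Sum>n | n \<in> {1..m} \<and> k \<le> n. card (S n \<inter> W k) / s k) \<le> card (W k) / s k"
      using pos[of k] by (simp add: sum_divide_distrib[symmetric] divide_right_mono
          flip: of_nat_sum)
  qed
  finally show ?thesis .
qed

section \<open>Spread of the fire from sphere to sphere\<close>

text \<open>A firefighter placed on a burning vertex is excluded by the second clause of
  \<^const>\<open>containment_strategy\<close>, so every unprotected neighbour of a burning vertex catches fire.\<close>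

lemma (in simple_graph) out_neighbours_burn:
  assumes "containment_strategy V E f X W" "burning V E W X n \<subseteq> V"
  shows "out_neighbours V E g m (burning V E W X n \<inter> sphere_at V E g m) -
      (\<Union>k\<in>{1..Suc n}. W k) \<subseteq> burning V E W X (Suc n) \<inter> sphere_at V E g (Suc m)"
proof -
  \<comment> \<open>Times \<open>k \<le> n\<close> are covered by the definition of
    \<open>burning\<close>, time \<open>Suc n\<close> by the second clause of the strategy.\<close>
  have "burning V E W X n \<inter> W k = {}" if "k \<in> {1..Suc n}" for k
    using assms(1) burning_disjoint_protected[of k n V E W X] that
    by (cases "k = Suc n") (auto simp: containment_strategy_def simp del: burning.simps)
  then have "burning V E W X n \<inter> (\<Union>k\<in>{1..Suc n}. W k) = {}"
    by blast
  then show ?thesis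
    by (fastforce simp: out_neighbours_def burning_Suc_iff[OF assms(2)] simp del: burning.simps)
qed

text \<open>Induction on time, with growth applied to the burning part of the current sphere. Growth
  is assumed in product form because that part may be empty.\<close>

lemma (in locally_finite_graph) burning_fraction_bound:
  assumes strat: "containment_strategy V E f (ball_at V E g R) W"
    and pos: "\<And>n. 0 < sphere_size V E g (R + n)"
    and growth: "\<And>n T. R \<le> n \<Longrightarrow> T \<subseteq> sphere_at V E g n \<Longrightarrow>
      card T * (sphere_size V E g (Suc n) / sphere_size V E g n) \<le> card (out_neighbours V E g n T)"
  shows "1 - (\<Sum>k=1..n. card (sphere_at V E g (R + k) \<inter> (\<Union>j\<in>{1..k}. W j)) /
        sphere_size V E g (R + k)) \<le>
    card (burning V E W (ball_at V E g R) n \<inter> sphere_at V E g (R + n)) / sphere_size V E g (R + n)"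
proof (induction n)
  case 0
  have "burning V E W (ball_at V E g R) 0 \<inter> sphere_at V E g (R + 0) = sphere_at V E g R"
    using sphere_at_subset_ball by fastforce
  then show ?case
    using pos[of 0] by (simp add: sphere_size_def)
next
  case (Suc n)
  let ?X = "burning V E W (ball_at V E g R)" and ?S = "\<lambda>n. sphere_at V E g (R + n)"
    and ?s = "\<lambda>n. real (sphere_size V E g (R + n))" and ?P = "\<Union>j\<in>{1..Suc n}. W j"
  let ?T = "?X n \<inter> ?S n"
  have XV: "?X n \<subseteq> V"
    using burning_subset_ball[of "ball_at V E g R" g R] ball_at_subset by fast
  let ?O = "out_neighbours V E g (R + n) ?T"
  have "?O \<subseteq> (?X (Suc n) \<inter> ?S (Suc n)) \<union> (?S (Suc n) \<inter> ?P)"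
    using out_neighbours_burn[OF strat XV, of g "R + n"]
    by (auto simp: out_neighbours_def simp del: burning.simps)
  then have "card ?O \<le> card ((?X (Suc n) \<inter> ?S (Suc n)) \<union> (?S (Suc n) \<inter> ?P))"
    by (intro card_mono) (simp_all add: finite_sphere_at)
  also have "\<dots> \<le> card (?X (Suc n) \<inter> ?S (Suc n)) + card (?S (Suc n) \<inter> ?P)"
    by (rule card_Un_le)
  finally have "card ?T * (?s (Suc n) / ?s n) \<le>
      card (?X (Suc n) \<inter> ?S (Suc n)) + card (?S (Suc n) \<inter> ?P)"
    using growth[of "R + n" ?T] by (auto simp del: burning.simps)
  \<comment> \<open>Dividing by the size of the next sphere cancels the growth ratio and turns
    counts into fractions.\<close>
  then have "card ?T * (?s (Suc n) / ?s n) / ?s (Suc n) \<le>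
      (card (?X (Suc n) \<inter> ?S (Suc n)) + card (?S (Suc n) \<inter> ?P)) / ?s (Suc n)"
    by (intro divide_right_mono) auto
  then have "card ?T / ?s n \<le>
      card (?X (Suc n) \<inter> ?S (Suc n)) / ?s (Suc n) + card (?S (Suc n) \<inter> ?P) / ?s (Suc n)"
    using pos[of "Suc n"] by (simp add: add_divide_distrib del: burning.simps)
  then show ?case
    using Suc by (simp del: burning.simps)
qed

section \<open>Divergence of the series\<close>

theorem theorem3p2:
  fixes V :: "'a set" and E :: "'a set set" and g\<^sub>0 :: 'a and f :: "nat \<Rightarrow> nat"
  assumes "locally_finite_graph V E"
    and "g\<^sub>0 \<in> V"
    and "homogeneous_growth V E g\<^sub>0"
    and "\<forall>n\<ge>1. f n > 0"
    and "\<forall>m n. 1 \<le> m \<and> m \<le> n \<longrightarrow> f m \<le> f n"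
    and "containment_property V E f"
  shows "(\<Sum>n. of_nat (f (Suc n)) / of_nat (sphere_size V E g\<^sub>0 (Suc n)) :: ennreal) = \<infinity>"
proof -
  interpret locally_finite_graph V E
    by fact
  let ?s = "sphere_size V E g\<^sub>0" and ?S = "sphere_at V E g\<^sub>0"
  show ?thesis
  proof (cases "\<exists>n. ?s (Suc n) = 0")
    \<comment> \<open>An empty sphere gives an infinite term. Positivity of \<open>f\<close>
      matters: \<open>0 / 0\<close> is \<open>0\<close> in \<open>ennreal\<close>.\<close>
    case True
    then obtain n where "?s (Suc n) = 0" ..
    then have "of_nat (f (Suc n)) / of_nat (?s (Suc n)) = (\<infinity>::ennreal)"
      using assms(4) by (simp add: ennreal_divide_zero infinity_ennreal_def)
    moreover have "of_nat (f (Suc n)) / of_nat (?s (Suc n)) \<le>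
        (\<Sum>n. of_nat (f (Suc n)) / of_nat (?s (Suc n)) :: ennreal)"
      using sum_le_suminf[of "\<lambda>n. of_nat (f (Suc n)) / of_nat (?s (Suc n)) :: ennreal" "{n}"] by simp
    ultimately show ?thesis
      by (simp add: top_unique infinity_ennreal_def)
  next
    case False
    then have pos: "?s (Suc n) > 0" for n
      by simp
    have "\<not> summable (\<lambda>n. real (f (Suc n)) / real (?s (Suc n)))"
    proof
      assume summ: "summable (\<lambda>n. real (f (Suc n)) / real (?s (Suc n)))"
      obtain r where r: "\<And>n T. n \<ge> r \<Longrightarrow> T \<subseteq> ?S n \<Longrightarrow> T \<noteq> {} \<Longrightarrow>
          card (out_neighbours V E g\<^sub>0 n T) / card T \<ge> ?s (Suc n) / ?s n \<and> ?s (Suc n) / ?s n \<ge> (1::real)"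
        using assms(3) unfolding homogeneous_growth_def by meson
      \<comment> \<open>\<open>R\<close> is beyond the growth threshold and positive, so that every
        \<open>R + n\<close> is a successor and \<open>pos\<close> applies. The tail starts at index
        \<open>R + 1\<close>, the sphere to be reached at time 1.\<close>
      obtain R where R: "Suc r \<le> R" and tail: "\<And>m. (\<Sum>k<m. f (Suc (k + R)) / ?s (Suc (k + R))) < (1::real)"
        using tail_sums_less[OF summ, of 1 "Suc r"] by auto
      have posR: "0 < ?s (R + n)" for n
        using R pos[of "R + n - 1"] by simp
      \<comment> \<open>Growth speaks of non-empty sets only; the whole sphere serves as
        one.\<close>
      have "?s (R + n) \<le> ?s (R + Suc n)" for n
      proof -
        have "?S (R + n) \<noteq> {}"
          using posR[of n] by (auto simp: sphere_size_def)
        then have "?s (R + Suc n) / ?s (R + n) \<ge> (1::real)"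
          using r[of "R + n" "?S (R + n)"] R by auto
        then show ?thesis
          using posR[of n] by simp
      qed
      then have mono: "?s (R + m) \<le> ?s (R + n)" if "m \<le> n" for m n
        using that by (rule lift_Suc_mono_le)
      have growth: "card T * (?s (Suc n) / ?s n) \<le> card (out_neighbours V E g\<^sub>0 n T)"
        if "R \<le> n" "T \<subseteq> ?S n" for n T
      proof (cases "T = {}")
        case False
        then have "card T > 0"
          using that finite_sphere_at by (auto simp: card_gt_0_iff intro: finite_subset)
        then show ?thesis
          using r[of n T] that R False by (simp add: pos_le_divide_eq mult.commute)
      qed simp
      let ?B = "ball_at V E g\<^sub>0 R"
      obtain W where W: "containment_strategy V E f ?B W"
        using assms(6) ball_at_subset[of V E g\<^sub>0 R] finite_ball_at[of g\<^sub>0 R]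
        unfolding containment_property_def by auto
      \<comment> \<open>The fire gains nothing from time \<open>N\<close> to \<open>Suc N\<close>.
        Hence at time \<open>Suc N\<close> it still lies within radius \<open>R + N\<close>, while
        the fraction bound will place it on the sphere of radius \<open>R + Suc N\<close>.\<close>
      then obtain N where N: "burning V E W ?B (Suc N) = burning V E W ?B N"
        unfolding containment_strategy_def by (metis le_SucI order_refl)
      have Wf: "finite (W k)" "card (W k) \<le> f k" if "k \<ge> 1" for k
        using W that unfolding containment_strategy_def by auto
      have "(\<Sum>k=1..Suc N. card (?S (R + k) \<inter> (\<Union>j\<in>{1..k}. W j)) / real (?s (R + k))) \<le>
          (\<Sum>k=1..Suc N. card (W k) / real (?s (R + k)))"
        using Wf posR mono by (intro sum_protected_le) (auto intro!: sphere_at_disjoint)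
      \<comment> \<open>Monotonicity of \<open>f\<close> shifts the numerator from \<open>k\<close>
        to \<open>R + k\<close>, matching the index of the sphere.\<close>
      also have "\<dots> \<le> (\<Sum>k=1..Suc N. f (R + k) / real (?s (R + k)))"
      proof (intro sum_mono divide_right_mono)
        fix k
        assume "k \<in> {1..Suc N}"
        then show "real (card (W k)) \<le> real (f (R + k))"
          using Wf(2)[of k] assms(5)[rule_format, of k "R + k"] by simp
      qed simp
      also have "\<dots> = (\<Sum>k<Suc N. f (Suc (k + R)) / ?s (Suc (k + R)))"
        unfolding One_nat_def sum.atLeast_Suc_atMost_Suc_shift atMost_atLeast0[symmetric]
          lessThan_Suc_atMost by (simp add: add.commute)
      also have "\<dots> < 1"
        by (rule tail)
      finally have "0 < 1 - (\<Sum>k=1..Suc N. card (?S (R + k) \<inter> (\<Union>j\<in>{1..k}. W j)) / real (?s (R + k)))"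
        by simp
      also have "\<dots> \<le> card (burning V E W ?B (Suc N) \<inter> ?S (R + Suc N)) / ?s (R + Suc N)"
        using W posR growth by (rule burning_fraction_bound)
      finally have "burning V E W ?B (Suc N) \<inter> ?S (R + Suc N) \<noteq> {}"
        by (metis card.empty div_0 less_irrefl of_nat_0)
      moreover have "burning V E W ?B (Suc N) \<subseteq> ball_at V E g\<^sub>0 (R + N)"
        unfolding N by (rule burning_subset_ball) simp
      ultimately show False
        using sphere_at_disjoint_ball[of "R + N" "R + Suc N" V E g\<^sub>0] by auto
    qed
    then show ?thesis
      using series_infinite_iff_not_summable[of ?s f, OF pos] by blast
  qed
qed

end
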